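(* Let $N\ge 5$ be an odd integer. The number of spanning trees of $G_N^{(1)}$ is \[ t(G_N^{(1)})=\frac{\mathcal P_N(N)+2}{N^2}, \] where $\mathcal P_N(N)=\alpha^N+\beta^N$ with $\alpha=\frac{N-2+\sqrt{\Delta}}{2}$, $\beta=\frac{N-2-\sqrt{\Delta}}{2}$ and $\Delta=N(N-4)$.
   Context: $G_N^{(1)}=K_N\setminus C_N$ is the graph on $\mathbb Z/N\mathbb Z$ in which distinct $x,y$ are adjacent iff $x-y\not\equiv\pm1\pmod N$. $t(G)$ denotes the number of spanning trees of a graph $G$. The number $\mathcal P_k(N)=\alpha^k+\beta^k$ is called the $k$-th Pisa number. *)

theory Defs
  imports Complex_Main "HOL-Number_Theory.Cong" "Graph_Theory.Graph_Theory"
begin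

text \<open>
  A finite simple graph is a \<open>pair_graph\<close>: finite vertex set, arcs given by a symmetric
  irreflexive relation, so that each undirected edge is a pair of opposite arcs. The constants
  \<open>tree\<close> and \<open>spanning_tree\<close> of the library do not fit this representation: their acyclicity
  also forbids the closed walks of length two along an edge and back. In a \<open>pair_graph\<close>, the
  usual (undirected) cycles are exactly the library's cycles of length at least three.
\<close>

definition undirected_tree :: "'a pair_pre_digraph \<Rightarrow> bool" where
  "undirected_tree H \<longleftrightarrow> pair_graph H \<and> Digraph_Component.connected (with_proj H) \<and>
     \<not> (\<exists>p. pre_digraph.cycle (with_proj H) p \<and> 3 \<le> length p)"

definition spanning_trees :: "'a pair_pre_digraph \<Rightarrow> 'a pair_pre_digraph set" where
  "spanning_trees G = {H. undirected_tree H \<and> spanning (with_proj H) (with_proj G)}"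

definition num_spanning_trees :: "'a pair_pre_digraph \<Rightarrow> nat" where
  "num_spanning_trees G = card (spanning_trees G)"

lemma finite_spanning_trees:
  assumes "pair_graph G"
  shows "finite (spanning_trees G)"
proof -
  interpret pair_graph G by fact
  have "spanning_trees G \<subseteq> (\<lambda>A. \<lparr>pverts = pverts G, parcs = A\<rparr>) ` Pow (parcs G)"
  proof
    fix H assume "H \<in> spanning_trees G"
    then have "pverts H = pverts G" "parcs H \<subseteq> parcs G"
      by (auto simp: spanning_trees_def spanning_def subgraph_def)
    then show "H \<in> (\<lambda>A. \<lparr>pverts = pverts G, parcs = A\<rparr>) ` Pow (parcs G)"
      by (cases H) auto
  qed
  then show ?thesis by (rule finite_subset) simp
qed

text \<open>The graph \<open>K\<^sub>N\<close> minus \<open>C\<^sub>N\<close>, with the residues \<open>0, \<dots>, N - 1\<close> representing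
  the integers modulo \<open>N\<close>.\<close>

definition complete_minus_cycle :: "nat \<Rightarrow> int pair_pre_digraph" where
  "complete_minus_cycle N =
     \<lparr>pverts = {0..<int N},
      parcs = {(x, y). x \<in> {0..<int N} \<and> y \<in> {0..<int N} \<and> x \<noteq> y \<and>
                 \<not> [x - y = 1] (mod int N) \<and> \<not> [x - y = - 1] (mod int N)}\<rparr>"

lemma pair_graph_complete_minus_cycle: "pair_graph (complete_minus_cycle N)"
proof
  let ?G = "complete_minus_cycle N"
  show "finite (pverts ?G)"
    by (simp add: complete_minus_cycle_def)
  have "parcs ?G \<subseteq> {0..<int N} \<times> {0..<int N}"
    by (auto simp: complete_minus_cycle_def)
  then show "finite (parcs ?G)"
    by (rule finite_subset) simp
  have "[x - y = c] (mod int N) \<longleftrightarrow> [y - x = - c] (mod int N)" for x y c :: int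
    using cong_minus_minus_iff[of "x - y" c "int N"] by simp
  from this[of _ _ 1] this[of _ _ "- 1"] show "symmetric (with_proj ?G)"
    by (auto simp: complete_minus_cycle_def symmetric_def arcs_ends_def sym_def arc_to_ends_def)
qed (auto simp: complete_minus_cycle_def)

definition pisa_disc :: "nat \<Rightarrow> real" where
  "pisa_disc N = real N * (real N - 4)"

definition pisa_alpha :: "nat \<Rightarrow> real" where
  "pisa_alpha N = (real N - 2 + sqrt (pisa_disc N)) / 2"

definition pisa_beta :: "nat \<Rightarrow> real" where
  "pisa_beta N = (real N - 2 - sqrt (pisa_disc N)) / 2"

text \<open>\<open>pisa k N\<close> is the \<open>k\<close>-th Pisa number for the parameter \<open>N\<close>. For \<open>N < 4\<close> the discriminant
  may be negative and the real \<open>sqrt\<close> is then not the intended (complex) root.\<close>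

definition pisa :: "nat \<Rightarrow> nat \<Rightarrow> real" where
  "pisa k N = pisa_alpha N ^ k + pisa_beta N ^ k"

end

theory Submission
  imports Defs "Jordan_Normal_Form.Determinant"
begin

text \<open>
  A spanning tree rooted at \<open>r\<close> is the same as an acyclic map sending every vertex other than
  \<open>r\<close> to a neighbour. Expanding the reduced Laplacian determinant multilinearly in its rows gives
  one term for every map to neighbours, equal to 1 if the map is acyclic and to 0 otherwise; this
  is the matrix-tree theorem. In the form \<open>det (J + L) = n\<^sup>2 * t(G)\<close>, with the all-ones
  matrix \<open>J\<close>, it turns the complement of a cycle into the circulant matrix
  \<open>(N - 2) + S + transpose S\<close>, where \<open>S\<close> is the cyclic shift. Since \<open>\<alpha> + \<beta> = N - 2\<close> and
  \<open>\<alpha> * \<beta> = 1\<close>, this matrix factors as \<open>(\<alpha> + S) * (1 + \<beta> * transpose S)\<close>, whose determinant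
  is \<open>(\<alpha>\<^sup>N + 1) * (1 + \<beta>\<^sup>N)\<close> for odd \<open>N\<close>.
\<close>

section \<open>Spanning trees and parent maps\<close>

text \<open>The rank function \<open>d\<close> encodes that iterating \<open>g\<close> from any vertex leads to the
  root; this form of acyclicity transfers along bijections of the vertex set.\<close>

definition parent_maps :: "'a pair_pre_digraph \<Rightarrow> 'a \<Rightarrow> ('a \<Rightarrow> 'a) set" where
  "parent_maps G r = {g \<in> (\<Pi>\<^sub>E v \<in> pverts G - {r}. {u. (v, u) \<in> parcs G}).
     \<exists>d :: 'a \<Rightarrow> nat. \<forall>v \<in> pverts G - {r}. d (g v) < d v}"

definition parent_graph :: "'a set \<Rightarrow> 'a \<Rightarrow> ('a \<Rightarrow> 'a) \<Rightarrow> 'a pair_pre_digraph" where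
  "parent_graph V r g = \<lparr>pverts = V,
     parcs = (\<lambda>v. (v, g v)) ` (V - {r}) \<union> (\<lambda>v. (g v, v)) ` (V - {r})\<rparr>"

section \<open>Walks as arc lists, and cycles in the graph of a parent map\<close>

lemma pcas_nth_Suc: "pcas u p v \<Longrightarrow> Suc i < length p \<Longrightarrow> snd (p ! i) = fst (p ! Suc i)"
proof (induction p arbitrary: u i)
  case (Cons e p)
  show ?case
  proof (cases i)
    case 0
    with Cons.prems show ?thesis by (cases p) auto
  next
    case (Suc j)
    with Cons.prems Cons.IH[of "snd e" j] show ?thesis by auto
  qed
qed simp

lemma pcas_fst_hd: "pcas u p v \<Longrightarrow> p \<noteq> [] \<Longrightarrow> fst (hd p) = u"
  by (cases p) auto

lemma pcas_snd_last: "pcas u p v \<Longrightarrow> p \<noteq> [] \<Longrightarrow> snd (last p) = v"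
  by (induction p arbitrary: u) (auto split: if_splits)

lemma pawalk_verts_conv: "pcas u p v \<Longrightarrow> pawalk_verts u p = u # map snd p"
  by (induction p arbitrary: u) auto

lemma parent_graph_no_cycle:
  fixes d :: "'a \<Rightarrow> nat"
  assumes d: "\<And>v. v \<in> V - {r} \<Longrightarrow> d (g v) < d v"
    and p: "pre_digraph.cycle (with_proj (parent_graph V r g)) p"
  shows "length p < 3"
proof (rule ccontr)
  assume "\<not> length p < 3"
  then have n: "3 \<le> length p" by simp
  let ?n = "length p"
  obtain u where arcs: "set p \<subseteq> parcs (parent_graph V r g)" and cas: "pcas u p u"
    and dist: "distinct (map snd p)"
    using p unfolding pre_digraph.cycle_def pre_digraph.awalk_def cas_with_proj_eq
      awalk_verts_with_proj_eq by (auto simp: pawalk_verts_conv)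
  have ne: "p \<noteq> []" using n by auto
  \<comment> \<open>Both neighbours on the cycle of a vertex of maximal rank would be its parent.\<close>
  obtain i where i: "i < ?n" and max: "\<And>j. j < ?n \<Longrightarrow> d (snd (p ! j)) \<le> d (snd (p ! i))"
  proof -
    have "\<exists>x \<in> (\<lambda>i. d (snd (p ! i))) ` {..<?n}. \<forall>y \<in> (\<lambda>i. d (snd (p ! i))) ` {..<?n}. y \<le> x"
      using ne by (intro bexI[of _ "Max ((\<lambda>i. d (snd (p ! i))) ` {..<?n})"] ballI Max_ge Max_in) auto
    then show ?thesis using that by auto
  qed
  \<comment> \<open>\<open>j\<close> and \<open>k\<close> index the next and the previous arc around
    the cycle, with wrap-around. The heads of these arcs are the two neighbours of
    \<open>snd (p ! i)\<close>. The indices differ only from length 3 on: a closed walk along an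
    edge and back has \<open>j = k\<close>.\<close>
  define j where "j = (if i = ?n - 1 then 0 else i + 1)"
  define k where "k = (if i = 0 then ?n - 1 else i - 1)"
  have wrap: "snd (p ! (?n - 1)) = fst (p ! 0)"
    using pcas_fst_hd[OF cas ne] pcas_snd_last[OF cas ne] ne by (simp add: hd_conv_nth last_conv_nth)
  have j: "j < ?n" "fst (p ! j) = snd (p ! i)"
    using i n wrap pcas_nth_Suc[OF cas, of i] by (auto simp: j_def)
  have k: "k < ?n" "snd (p ! k) = fst (p ! i)"
    using i n wrap pcas_nth_Suc[OF cas, of "i - 1"] by (auto simp: k_def)
  \<comment> \<open>Every arc joins a vertex to its parent, in one direction or the other, and the
    parent has strictly smaller rank. So the end whose rank is not larger must be the
    parent.\<close>
  have parent: "b = g a" if "(a, b) \<in> set p \<or> (b, a) \<in> set p" "d b \<le> d a" for a b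
    using that arcs d by (fastforce simp: parent_graph_def)
  have "snd (p ! j) = g (snd (p ! i))"
    using nth_mem[OF j(1)] max[OF j(1)] j(2) by (intro parent) (metis prod.collapse)+
  moreover have "snd (p ! k) = g (snd (p ! i))"
    using nth_mem[OF i] max[OF k(1)] k(2) by (intro parent) (metis prod.collapse)+
  ultimately have "j = k"
    using dist j(1) k(1) by (simp add: distinct_conv_nth) metis
  then show False using n i by (auto simp: j_def k_def split: if_splits)
qed

lemma parent_graph_reachable_root:
  fixes d :: "'a \<Rightarrow> nat"
  assumes d: "\<And>v. v \<in> V - {r} \<Longrightarrow> d (g v) < d v"
    and g: "\<And>v. v \<in> V - {r} \<Longrightarrow> g v \<in> V"
    and "r \<in> V" "v \<in> V"
  shows "v \<rightarrow>\<^sup>*\<^bsub>with_proj (parent_graph V r g)\<^esub> r"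
  using \<open>v \<in> V\<close>
proof (induction "d v" arbitrary: v rule: less_induct)
  case less
  have "\<forall>w \<in> V - {r}. g w \<in> V"
    using g by blast
  then interpret pair_wf_digraph "parent_graph V r g"
    using \<open>r \<in> V\<close> by unfold_locales (auto simp: parent_graph_def)
  show ?case
  proof (cases "v = r")
    case True
    moreover have "r \<in> pverts (parent_graph V r g)"
      using \<open>r \<in> V\<close> by (simp add: parent_graph_def)
    ultimately show ?thesis using reachable_refl by simp
  next
    case False
    with less.prems have "v \<in> V - {r}" by simp
    with less.hyps[of "g v"] d g have "g v \<rightarrow>\<^sup>*\<^bsub>with_proj (parent_graph V r g)\<^esub> r" by blast
    moreover have "(v, g v) \<in> parcs (parent_graph V r g)"
      using \<open>v \<in> V - {r}\<close> by (auto simp: parent_graph_def)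
    ultimately show ?thesis by (metis adj_reachable_trans)
  qed
qed

text \<open>The library's \<open>connected\<close> means strong connectivity of the symmetric
  closure. For graphs whose arcs are already symmetric, this removes the closure.\<close>

lemma mk_symmetric_parcs:
  assumes "\<And>u v. (u, v) \<in> parcs H \<Longrightarrow> (v, u) \<in> parcs H"
  shows "mk_symmetric (with_proj H) = H"
  using assms by (cases H) (auto simp: mk_symmetric_def)

section \<open>The bijection between parent maps and spanning trees\<close>

context pair_graph
begin

lemma parent_mapsE:
  assumes "g \<in> parent_maps G r"
  obtains d :: "'a \<Rightarrow> nat" where "\<And>v. v \<in> pverts G - {r} \<Longrightarrow> d (g v) < d v"
    "\<And>v. v \<in> pverts G - {r} \<Longrightarrow> (v, g v) \<in> parcs G"
    "\<And>v. v \<in> pverts G - {r} \<Longrightarrow> g v \<in> pverts G"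
proof -
  obtain d :: "'a \<Rightarrow> nat" where d: "\<And>v. v \<in> pverts G - {r} \<Longrightarrow> d (g v) < d v"
    using assms by (auto simp: parent_maps_def)
  have "(v, g v) \<in> parcs G" if "v \<in> pverts G - {r}" for v
    using assms that unfolding parent_maps_def by blast
  with d show ?thesis using that in_arcsD2 by metis
qed

lemma sym_parcs: "(u, v) \<in> parcs G \<Longrightarrow> (v, u) \<in> parcs G"
  using arcs_symmetric by auto

lemma parent_graph_spanning_tree:
  assumes r: "r \<in> pverts G" and g: "g \<in> parent_maps G r"
  shows "parent_graph (pverts G) r g \<in> spanning_trees G"
proof -
  let ?H = "parent_graph (pverts G) r g"
  obtain d :: "'a \<Rightarrow> nat" where d: "\<And>v. v \<in> pverts G - {r} \<Longrightarrow> d (g v) < d v"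
    and arc: "\<And>v. v \<in> pverts G - {r} \<Longrightarrow> (v, g v) \<in> parcs G"
    and gV: "\<And>v. v \<in> pverts G - {r} \<Longrightarrow> g v \<in> pverts G"
    using parent_mapsE[OF g] by metis
  have sub: "parcs ?H \<subseteq> parcs G" and V: "pverts ?H = pverts G"
    using arc sym_parcs by (auto simp: parent_graph_def)
  have pg: "pair_graph ?H"
  proof
    show "finite (parcs ?H)" using sub pair_finite_arcs finite_subset by blast
    show "symmetric (with_proj ?H)"
      by (auto simp: symmetric_def sym_def parent_graph_def)
    show "fst e \<noteq> snd e" if "e \<in> parcs ?H" for e using that sub pair_no_loops by blast
  qed (use sub V wellformed' in auto)
  interpret H: pair_graph ?H by fact
  \<comment> \<open>Any two vertices are joined through the root, the path from \<open>v\<close> to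
    \<open>r\<close> being reversed by symmetry.\<close>
  have "u \<rightarrow>\<^sup>*\<^bsub>with_proj ?H\<^esub> v" if "u \<in> pverts G" "v \<in> pverts G" for u v
    using that parent_graph_reachable_root[where d=d, OF d gV r] H.symmetric_reachable' H.reachable_trans
    by metis
  then have "strongly_connected (with_proj ?H)" using r V by auto
  then have "Digraph_Component.connected (with_proj ?H)"
    unfolding Digraph_Component.connected_def using H.sym_parcs
    by (simp add: mk_symmetric_parcs)
  moreover have "\<not> (\<exists>p. pre_digraph.cycle (with_proj ?H) p \<and> 3 \<le> length p)"
    using parent_graph_no_cycle[where d=d, OF d] by fastforce
  moreover have "spanning (with_proj ?H) (with_proj G)"
    using sub V by (auto simp: spanning_def subgraph_def compatible_def H.wf_digraph wf_digraph)
  ultimately show ?thesis using pg by (auto simp: spanning_trees_def undirected_tree_def)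
qed

text \<open>Only the orientation of an edge could be ambiguous: if \<open>f v\<close> and
  \<open>g v\<close> differ, the edge from \<open>v\<close> to \<open>f v\<close> must come from
  \<open>g (f v) = v\<close>. By induction on the rank for \<open>f\<close>, the maps agree at
  \<open>f v\<close>, so \<open>f (f v) = v\<close>, although \<open>f\<close> lowers the rank
  twice.\<close>

lemma inj_on_parent_graph:
  "inj_on (parent_graph (pverts G) r) (parent_maps G r)"
proof (rule inj_onI, rule ccontr)
  fix f g
  assume f: "f \<in> parent_maps G r" and g: "g \<in> parent_maps G r"
    and eq: "parent_graph (pverts G) r f = parent_graph (pverts G) r g" and "f \<noteq> g"
  let ?V = "pverts G - {r}"
  obtain d :: "'a \<Rightarrow> nat" where d: "\<And>v. v \<in> ?V \<Longrightarrow> d (f v) < d v"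
    using parent_mapsE[OF f] by metis
  have cases: "f v = g v \<or> f v \<in> ?V \<and> g (f v) = v" if "v \<in> ?V" for v
  proof -
    have "(v, f v) \<in> parcs (parent_graph (pverts G) r f)" using that by (auto simp: parent_graph_def)
    then show ?thesis unfolding eq by (auto simp: parent_graph_def)
  qed
  have "f v = g v" if "v \<in> ?V" for v
    using that
  proof (induction "d v" arbitrary: v rule: less_induct)
    case less
    show ?case
    proof (rule ccontr)
      assume "f v \<noteq> g v"
      with cases[OF less.prems] have *: "f v \<in> ?V" "g (f v) = v" by auto
      then have "f (f v) = v" using less d by metis
      with d[OF less.prems] d[OF *(1)] show False by simp
    qed
  qed
  moreover have "f \<in> extensional ?V" "g \<in> extensional ?V"
    using f g by (auto simp: parent_maps_def PiE_iff)
  ultimately show False using \<open>f \<noteq> g\<close> extensionalityI by blast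
qed

text \<open>The distance \<open>d\<close> to \<open>r\<close> in \<open>H\<close> serves as the
  rank, and each other vertex chooses a neighbour closer to \<open>r\<close> as its parent. The
  chosen edges already form a connected spanning subgraph \<open>?T\<close> of \<open>H\<close>, and
  acyclicity of \<open>H\<close> leaves no room for further edges.\<close>

lemma spanning_tree_parent_graph:
  assumes r: "r \<in> pverts G" and H: "H \<in> spanning_trees G"
  shows "H \<in> parent_graph (pverts G) r ` parent_maps G r"
proof -
  have pg: "pair_graph H" and conn: "Digraph_Component.connected (with_proj H)"
    and acyc: "\<And>p. pre_digraph.cycle (with_proj H) p \<Longrightarrow> length p < 3"
    and V: "pverts H = pverts G" and sub: "parcs H \<subseteq> parcs G"
    using H by (force simp: spanning_trees_def undirected_tree_def spanning_def subgraph_def)+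
  interpret H: pair_graph H by fact
  have sc: "strongly_connected (with_proj H)"
    using H.symmetric_connected_imp_strongly_connected[OF H.pair_sym_arcs conn] .
  have reach: "\<exists>k. (v, r) \<in> parcs H ^^ k" if "v \<in> pverts G" for v
  proof -
    have "v \<rightarrow>\<^sup>*\<^bsub>with_proj H\<^esub> r"
      using sc that r V by (simp add: strongly_connected_def)
    then have "(v, r) \<in> (parcs H)\<^sup>*"
      using reachable_rtranclI[of "with_proj H"] by simp
    then show ?thesis by (rule rtrancl_imp_relpow)
  qed
  define d where "d v = (LEAST k. (v, r) \<in> parcs H ^^ k)" for v
  have "\<exists>u. (v, u) \<in> parcs H \<and> d u < d v" if v: "v \<in> pverts G - {r}" for v
  proof -
    have k: "(v, r) \<in> parcs H ^^ d v"
      using LeastI_ex[OF reach[of v]] v by (simp add: d_def)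
    with v obtain m where m: "d v = Suc m" by (cases "d v") auto
    with k obtain u where u: "(v, u) \<in> parcs H" "(u, r) \<in> parcs H ^^ m"
      by (metis relpow_Suc_D2)
    then have "d u \<le> m" unfolding d_def by (intro Least_le)
    with m u show ?thesis by auto
  qed
  then obtain f where f: "\<And>v. v \<in> pverts G - {r} \<Longrightarrow> (v, f v) \<in> parcs H \<and> d (f v) < d v"
    by metis
  define g where "g = restrict f (pverts G - {r})"
  have g: "(v, g v) \<in> parcs H" "d (g v) < d v" if "v \<in> pverts G - {r}" for v
    using f[OF that] that by (auto simp: g_def)
  have gG: "g \<in> parent_maps G r"
    unfolding parent_maps_def using g sub by (auto simp: g_def)
  let ?T = "parent_graph (pverts G) r g"
  have VT: "pverts ?T = pverts G" by (simp add: parent_graph_def)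
  have T: "parcs ?T \<subseteq> parcs H"
    using g H.arcs_symmetric by (auto simp: parent_graph_def)
  have "pair_graph ?T" and connT: "Digraph_Component.connected (with_proj ?T)"
    using parent_graph_spanning_tree[OF r gG] by (auto simp: spanning_trees_def undirected_tree_def)
  then interpret T: pair_graph ?T by simp
  have scT: "strongly_connected (with_proj ?T)"
    using T.symmetric_connected_imp_strongly_connected[OF T.pair_sym_arcs connT] .
  \<comment> \<open>An arc outside \<open>?T\<close> would close the path in \<open>?T\<close> between its ends to a cycle.\<close>
  have "(a, b) \<in> parcs ?T" if ab: "(a, b) \<in> parcs H" for a b
  proof (rule ccontr)
    assume nT: "(a, b) \<notin> parcs ?T"
    have "a \<in> pverts G" "b \<in> pverts G" using ab V H.wellformed' by auto
    then have "a \<rightarrow>\<^sup>*\<^bsub>with_proj ?T\<^esub> b"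
      using scT VT by (simp add: strongly_connected_def)
    then obtain p where "T.apath a p b"
      unfolding T.reachable_apath by (elim exE)
    then have aw: "T.awalk a p b" and dist: "distinct (pawalk_verts a p)"
      by (auto simp: T.apath_def)
    have awH: "H.awalk a p b"
      using aw T V VT by (auto simp: T.awalk_def H.awalk_def)
    have "a \<noteq> b" using ab H.pair_no_loops by fastforce
    \<comment> \<open>With the closing arc this makes a cycle of length at least 3, the only kind
      that is forbidden. An empty path would give \<open>a = b\<close>, and a single arc would be
      \<open>(a, b)\<close> itself.\<close>
    have "length p \<ge> 2"
    proof (rule ccontr)
      assume "\<not> 2 \<le> length p"
      then consider "p = []" | e where "p = [e]" by (cases p) (auto simp: Suc_le_eq not_le)
      then show False
        using aw \<open>a \<noteq> b\<close> nT by cases (auto simp: T.awalk_def)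
    qed
    have ba: "H.awalk b [(b, a)] a"
      using ab H.arcs_symmetric V \<open>b \<in> pverts G\<close> by (auto simp: H.awalk_def)
    have awH': "H.awalk a (p @ [(b, a)]) a" using awH ba by (rule H.awalk_appendI)
    have "distinct (tl (pawalk_verts a (p @ [(b, a)])))"
    proof -
      have "pawalk_verts a p = a # map snd p"
        using awH pawalk_verts_conv[of a p b] by (simp add: H.awalk_def)
      moreover have "pawalk_verts a (p @ [(b, a)]) = a # map snd p @ [a]"
        using awH' pawalk_verts_conv[of a "p @ [(b, a)]" a] by (simp add: H.awalk_def)
      ultimately show ?thesis using dist by simp
    qed
    with awH' have "H.cycle (p @ [(b, a)])" unfolding H.cycle_def by blast
    with acyc \<open>length p \<ge> 2\<close> show False by fastforce
  qed
  with T have "parcs ?T = parcs H" by auto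
  then have "H = ?T" using V by (simp add: parent_graph_def)
  with gG show ?thesis by blast
qed

theorem num_spanning_trees_eq_card_parent_maps:
  assumes "r \<in> pverts G"
  shows "num_spanning_trees G = card (parent_maps G r)"
proof -
  have "bij_betw (parent_graph (pverts G) r) (parent_maps G r) (spanning_trees G)"
    using assms inj_on_parent_graph parent_graph_spanning_tree spanning_tree_parent_graph
    by (auto simp: bij_betw_def)
  then show ?thesis unfolding num_spanning_trees_def by (simp add: bij_betw_same_card)
qed

end

section \<open>The matrix-tree theorem\<close>

lemma sum_of_bool_eq_mult:
  fixes f :: "'b \<Rightarrow> 'a :: semiring_1"
  assumes "finite A"
  shows "(\<Sum>x \<in> A. of_bool (x = a) * f x) = (if a \<in> A then f a else 0)"
proof -
  have "(\<Sum>x \<in> A. of_bool (x = a) * f x) = (\<Sum>x \<in> A. if x = a then f x else 0)"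
    by (rule sum.cong) auto
  with assms show ?thesis by simp
qed

text \<open>Multilinearity in all rows at once: \<open>h\<close> selects one summand per row. It
  follows by multiplying out the product in each Leibniz term and exchanging the sums.\<close>

lemma det_sum_rows:
  fixes R :: "nat \<Rightarrow> 'b \<Rightarrow> nat \<Rightarrow> 'a :: comm_ring_1"
  assumes "\<And>i. i < n \<Longrightarrow> finite (S i)"
  shows "det (mat n n (\<lambda>(i, j). \<Sum>s \<in> S i. R i s j)) =
    (\<Sum>h \<in> (\<Pi>\<^sub>E i \<in> {0..<n}. S i). det (mat n n (\<lambda>(i, j). R i (h i) j)))"
proof -
  have "det (mat n n (\<lambda>(i, j). \<Sum>s \<in> S i. R i s j)) =
    (\<Sum>p | p permutes {0..<n}. signof p * (\<Prod>i = 0..<n. \<Sum>s \<in> S i. R i s (p i)))"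
    unfolding det_def by (auto intro!: sum.cong prod.cong dest: permutes_in_image)
  also have "\<dots> = (\<Sum>p | p permutes {0..<n}. \<Sum>h \<in> (\<Pi>\<^sub>E i \<in> {0..<n}. S i).
    signof p * (\<Prod>i = 0..<n. R i (h i) (p i)))"
    using assms by (subst prod_sum_PiE) (auto simp: sum_distrib_left)
  also have "\<dots> = (\<Sum>h \<in> (\<Pi>\<^sub>E i \<in> {0..<n}. S i). \<Sum>p | p permutes {0..<n}.
    signof p * (\<Prod>i = 0..<n. R i (h i) (p i)))"
    by (rule sum.swap)
  also have "\<dots> = (\<Sum>h \<in> (\<Pi>\<^sub>E i \<in> {0..<n}. S i). det (mat n n (\<lambda>(i, j). R i (h i) j)))"
    unfolding det_def by (auto intro!: sum.cong prod.cong dest: permutes_in_image)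
  finally show ?thesis .
qed

text \<open>If a rank exists, only the identity contributes to the Leibniz sum: for another
  permutation \<open>p\<close>, take a moved point \<open>i\<close> of least rank. A nonzero entry
  would need \<open>p i = h i\<close>, but \<open>p i\<close> is also moved and has smaller rank. If
  no rank exists, the matrix is singular.\<close>

lemma det_parent_matrix:
  fixes h :: "nat \<Rightarrow> nat"
  assumes h: "\<And>i. i \<in> {1..<n} \<Longrightarrow> h i < n"
  shows "det (mat n n (\<lambda>(i, j). of_bool (i = j) - of_bool (i \<noteq> 0 \<and> h i = j))) =
    (of_bool (\<exists>d :: nat \<Rightarrow> nat. \<forall>i \<in> {1..<n}. d (h i) < d i) :: 'a :: idom)"
    (is "det ?M = of_bool ?P")
proof (cases ?P)
  case True
  then obtain d :: "nat \<Rightarrow> nat" where d: "\<And>i. i \<in> {1..<n} \<Longrightarrow> d (h i) < d i" by blast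
  let ?f = "\<lambda>p. signof p * (\<Prod>i = 0..<n. ?M $$ (i, p i)) :: 'a"
  have zero: "?f p = 0" if p: "p permutes {0..<n}" and "p \<noteq> id" for p
  proof -
    have "{i. p i \<noteq> i} \<noteq> {}" using \<open>p \<noteq> id\<close> by auto
    then obtain i where i: "p i \<noteq> i" and min: "\<And>j. p j \<noteq> j \<Longrightarrow> d i \<le> d j"
      using ex_has_least_nat[of "\<lambda>i. p i \<noteq> i" _ d] by blast
    have "i < n" using i p by (metis atLeastLessThan_iff permutes_not_in zero_le)
    moreover from this have "p i < n" using p permutes_in_image by fastforce
    moreover have "\<not> (i \<noteq> 0 \<and> h i = p i)"
    proof
      assume *: "i \<noteq> 0 \<and> h i = p i"
      have "p (p i) \<noteq> p i" using i p by (metis permutes_inj injD)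
      with min d[of i] * \<open>i < n\<close> show False by fastforce
    qed
    ultimately have "?M $$ (i, p i) = 0" using i by auto
    then have "(\<Prod>i = 0..<n. ?M $$ (i, p i)) = 0"
      using \<open>i < n\<close> by (intro prod_zero) auto
    then show ?thesis by simp
  qed
  have "det ?M = (\<Sum>p | p permutes {0..<n}. ?f p)"
    by (rule det_def') simp
  also have "\<dots> = (\<Sum>p \<in> {id}. ?f p)"
    using zero by (intro sum.mono_neutral_right) (auto simp: finite_permutations permutes_id)
  also have "\<dots> = 1"
  proof -
    have "h i \<noteq> i" if "i < n" "i \<noteq> 0" for i
      using d[of i] that by auto
    then show ?thesis by (auto intro!: prod.neutral)
  qed
  finally show ?thesis using True by simp
next
  case False
  \<comment> \<open>The indicator vector of the points never reaching \<open>0\<close> lies in the kernel.\<close>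
  define S where "S = {i. \<forall>k. (h ^^ k) i \<noteq> 0}"
  let ?v = "vec n (\<lambda>i. of_bool (i \<in> S)) :: 'a vec"
  have step: "i \<in> S \<longleftrightarrow> h i \<in> S" if "i \<noteq> 0" for i
  proof
    assume "i \<in> S"
    then have "(h ^^ Suc k) i \<noteq> 0" for k unfolding S_def by blast
    then show "h i \<in> S" unfolding S_def by (simp add: funpow_swap1)
  next
    assume "h i \<in> S"
    then have "(h ^^ k) i \<noteq> 0" for k
      using that by (cases k) (auto simp: S_def funpow_swap1)
    then show "i \<in> S" unfolding S_def by blast
  qed
  have "0 \<notin> S"
  proof
    assume "0 \<in> S"
    then have "(h ^^ 0) 0 \<noteq> 0" unfolding S_def by blast
    then show False by simp
  qed
  have "?v \<noteq> 0\<^sub>v n"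
  proof
    \<comment> \<open>If every index reached \<open>0\<close>, the number of steps needed would be a
      rank function.\<close>
    assume v: "?v = 0\<^sub>v n"
    have notin: "i \<notin> S" if "i < n" for i
    proof -
      have "?v $ i = 0" unfolding v using that by simp
      then show ?thesis using that by simp
    qed
    have ex: "\<exists>k. (h ^^ k) i = 0" if "i < n" for i
      using notin[OF that] by (simp add: S_def)
    define d where "d i = (LEAST k. (h ^^ k) i = 0)" for i
    have "d (h i) < d i" if i: "i \<in> {1..<n}" for i
    proof -
      have k: "(h ^^ d i) i = 0" using LeastI_ex[OF ex[of i]] i by (simp add: d_def)
      with i obtain m where m: "d i = Suc m" by (cases "d i") auto
      with k have "(h ^^ m) (h i) = 0" by (simp add: funpow_swap1)
      then have "d (h i) \<le> m" unfolding d_def by (rule Least_le)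
      with m show ?thesis by simp
    qed
    with False show False by blast
  qed
  moreover have "?M *\<^sub>v ?v = 0\<^sub>v n"
  proof (rule eq_vecI)
    fix i assume "i < dim_vec (0\<^sub>v n :: 'a vec)"
    then have i: "i < n" by simp
    have "(?M *\<^sub>v ?v) $ i = (\<Sum>j = 0..<n. (of_bool (i = j) - of_bool (i \<noteq> 0 \<and> h i = j)) * of_bool (j \<in> S))"
      using i by (simp add: scalar_prod_def)
    also have "\<dots> = (\<Sum>j = 0..<n. of_bool (j = i) * of_bool (j \<in> S)) -
        of_bool (i \<noteq> 0) * (\<Sum>j = 0..<n. of_bool (j = h i) * of_bool (j \<in> S))"
      unfolding sum_distrib_left sum_subtractf[symmetric]
      by (rule sum.cong) auto
    also have "\<dots> = of_bool (i \<in> S) - of_bool (i \<noteq> 0) * of_bool (h i \<in> S)"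
      using i h[of i] by (cases "i = 0") (auto simp: sum_of_bool_eq_mult)
    also have "\<dots> = 0" using step[of i] \<open>0 \<notin> S\<close> by (cases "i = 0") auto
    finally show "(?M *\<^sub>v ?v) $ i = 0\<^sub>v n $ i" using i by simp
  qed simp
  ultimately have "det ?M = 0"
    by (subst det_0_iff_vec_prod_zero[of _ n]) (auto intro!: exI[of _ ?v])
  then show ?thesis using False by simp
qed

text \<open>Row \<open>i\<close> of a Laplacian is the sum of the vectors \<open>e_i - e_u\<close>
  over the neighbours \<open>u\<close> of \<open>i\<close>, so \<open>det_sum_rows\<close> yields
  one \<open>det_parent_matrix\<close> term per map. The root row is the single vector
  \<open>e_0\<close>; the dummy choice set \<open>{0}\<close> makes it count exactly once.\<close>

lemma det_rooted_laplacian: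
  fixes adj :: "nat \<Rightarrow> nat \<Rightarrow> bool" and n :: nat
  defines "S \<equiv> \<lambda>i. if i = 0 then {0} else {u. u < n \<and> adj i u}"
  assumes "n > 0"
  shows "det (mat n n (\<lambda>(i, j). if i = 0 then of_bool (j = 0)
      else of_bool (i = j) * of_nat (card {u. u < n \<and> adj i u}) - of_bool (adj i j))) =
    (of_nat (card {h \<in> (\<Pi>\<^sub>E i \<in> {0..<n}. S i).
       \<exists>d :: nat \<Rightarrow> nat. \<forall>i \<in> {1..<n}. d (h i) < d i}) :: 'a :: idom)"
    (is "det (mat n n ?f) = of_nat (card ?H)")
proof -
  let ?R = "\<lambda>i s j. of_bool (i = j) - of_bool (i \<noteq> 0 \<and> s = j) :: 'a"
  have fin: "finite (S i)" for i by (auto simp: S_def)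
  have "mat n n ?f = mat n n (\<lambda>(i, j). \<Sum>s \<in> S i. ?R i s j)"
  proof (rule cong_mat)
    fix i j assume "i < n" "j < n"
    then have single: "{u. u < n \<and> adj i u} \<inter> {u. u = j} = (if adj i j then {j} else {})"
      by auto
    from \<open>i < n\<close> \<open>j < n\<close> show "?f (i, j) = (case (i, j) of (i, j) \<Rightarrow> \<Sum>s \<in> S i. ?R i s j)"
      by (auto simp: S_def sum_subtractf sum_of_bool_eq single)
  qed simp_all
  then have "det (mat n n ?f) = (\<Sum>h \<in> (\<Pi>\<^sub>E i \<in> {0..<n}. S i). det (mat n n (\<lambda>(i, j). ?R i (h i) j)))"
    by (simp add: det_sum_rows fin)
  also have "\<dots> = (\<Sum>h \<in> (\<Pi>\<^sub>E i \<in> {0..<n}. S i).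
      of_bool (\<exists>d :: nat \<Rightarrow> nat. \<forall>i \<in> {1..<n}. d (h i) < d i))"
  proof (rule sum.cong[OF refl], rule det_parent_matrix)
    fix h i assume "h \<in> (\<Pi>\<^sub>E i \<in> {0..<n}. S i)" "i \<in> {1..<n}"
    then have "h i \<in> S i" "i \<noteq> 0" by auto
    then show "h i < n" by (simp add: S_def)
  qed
  also have "\<dots> = of_nat (card ?H)"
    by (simp add: sum_of_bool_eq finite_PiE fin Int_def)
  finally show ?thesis .
qed

section \<open>The determinant of the all-ones matrix plus a Laplacian\<close>

lemma mat_times_mat:
  fixes f g h :: "nat \<Rightarrow> nat \<Rightarrow> 'a :: semiring_0"
  assumes "\<And>i j. i < n \<Longrightarrow> j < n \<Longrightarrow> (\<Sum>k = 0..<n. f i k * g k j) = h i j"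
  shows "mat n n (\<lambda>(i, j). f i j) * mat n n (\<lambda>(i, j). g i j) = mat n n (\<lambda>(i, j). h i j)"
  using assms by (intro eq_matI) (auto simp: scalar_prod_def)

lemma det_one_mat_upd_row:
  assumes "n > 0"
  shows "det (mat n n (\<lambda>(i, j). if i = 0 then of_bool (j = 0) * c + of_bool (j \<noteq> 0) * b else of_bool (i = j))) = (c :: 'a :: idom)"
proof -
  let ?A = "mat n n (\<lambda>(i, j). if i = 0 then of_bool (j = 0) * c + of_bool (j \<noteq> 0) * b else of_bool (i = j)) :: 'a mat"
  have "det ?A = prod_list (diag_mat ?A)"
    by (rule det_upper_triangular[of _ n]) (auto simp: upper_triangular_def)
  also have "\<dots> = (\<Prod>i = 0..<n. if i = 0 then c else 1)"
    unfolding prod_list_diag_prod by (rule prod.cong) auto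
  also have "\<dots> = c"
    using assms by simp
  finally show ?thesis .
qed

lemma det_one_mat_upd_col:
  "det (mat n n (\<lambda>(i, j). if j = 0 \<and> i \<noteq> 0 then c else of_bool (i = j))) = (1 :: 'a :: idom)"
proof -
  let ?A = "mat n n (\<lambda>(i, j). if j = 0 \<and> i \<noteq> 0 then c else of_bool (i = j)) :: 'a mat"
  have "det ?A = prod_list (diag_mat ?A)"
    by (rule det_lower_triangular[of n]) auto
  also have "\<dots> = 1"
    by (auto simp: prod_list_diag_prod intro!: prod.neutral)
  finally show ?thesis .
qed

lemma det_all_ones_plus:
  fixes L :: "nat \<Rightarrow> nat \<Rightarrow> 'a :: idom"
  assumes n: "n > 0"
    and row: "\<And>i. i < n \<Longrightarrow> (\<Sum>j = 0..<n. L i j) = 0"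
    and col: "\<And>j. j < n \<Longrightarrow> (\<Sum>i = 0..<n. L i j) = 0"
  shows "det (mat n n (\<lambda>(i, j). 1 + L i j)) =
    of_nat n ^ 2 * det (mat n n (\<lambda>(i, j). if i = 0 then of_bool (j = 0) else L i j))"
proof -
  \<comment> \<open>The matrix factors as \<open>A * K * B\<close> with \<open>det A = det B = n\<close>; multiplying \<open>A\<close> and \<open>B\<close> by
    unitriangular matrices \<open>P c\<close> makes them upper triangular.\<close>
  let ?mat = "\<lambda>f. mat n n (\<lambda>(i, j). f i j :: 'a)"
  let ?K = "\<lambda>i j. if i = 0 then of_bool (j = 0) else L i j"
  let ?K1 = "\<lambda>i j. if i = 0 then 1 else L i j"
  let ?A = "\<lambda>i j. (if i = 0 then 2 * of_bool (j = 0) - 1 else of_bool (j = 0) + of_bool (j = i) :: 'a)"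
  let ?B = "\<lambda>i j. (of_bool (i = j) + of_bool (j \<noteq> 0) :: 'a)"
  let ?P = "\<lambda>c i j. (if j = 0 \<and> i \<noteq> 0 then c else of_bool (i = j) :: 'a)"
  let ?Q = "\<lambda>i j. (if i = 0 then 1 else of_bool (i = j) - of_bool (j = 0) :: 'a)"
  let ?U = "\<lambda>b i j. (if i = 0 then of_bool (j = 0) * of_nat n + of_bool (j \<noteq> 0) * b else of_bool (i = j) :: 'a)"
  have split0: "(\<Sum>k = 0..<n. f k) = f 0 + (\<Sum>k = Suc 0..<n. f k)" for f :: "nat \<Rightarrow> 'a"
    using n by (simp add: sum.atLeast_Suc_lessThan)
  have delta: "(\<Sum>k = Suc 0..<n. of_bool (k = i) * f k) = (if 0 < i \<and> i < n then f i else 0)"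
    for i and f :: "nat \<Rightarrow> 'a"
    by (auto simp: sum_of_bool_eq_mult)
  have delta1: "(\<Sum>k = Suc 0..<n. of_bool (k = i)) = (if 0 < i \<and> i < n then 1 else 0 :: 'a)" for i
    using delta[of i "\<lambda>_. 1"] by simp
  have delta': "(\<Sum>k = Suc 0..<n. of_bool (i = k) * f k) = (if 0 < i \<and> i < n then f i else 0)"
      "(\<Sum>k = Suc 0..<n. of_bool (i = k)) = (if 0 < i \<and> i < n then 1 else 0 :: 'a)"
    for i and f :: "nat \<Rightarrow> 'a"
    using delta[of i f] delta1[of i] by (simp_all add: eq_commute[of i])
  have pos: "(\<Sum>k = Suc 0..<n. f k) = (\<Sum>k = Suc 0..<n. g k)" if "\<And>k. k > 0 \<Longrightarrow> f k = g k"
    for f g :: "nat \<Rightarrow> 'a"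
    using that by (intro sum.cong) auto
  \<comment> \<open>Multiplying by \<open>?B\<close> adds the sum of all columns to every column but
    the first. Rows of \<open>L\<close> sum to 0 and stay; the unit row 0 becomes all ones.\<close>
  have K1: "?mat ?K * ?mat ?B = ?mat ?K1"
  proof (rule mat_times_mat)
    fix i j assume ij: "i < n" "j < n"
    have "(\<Sum>k = 0..<n. L i k * ?B k j) =
        (\<Sum>k = 0..<n. of_bool (k = j) * L i k) + (\<Sum>k = 0..<n. L i k) * of_bool (j \<noteq> 0)"
      by (simp add: distrib_left sum.distrib sum_distrib_right mult.commute)
    also have "\<dots> = L i j"
      using ij row by (simp add: sum_of_bool_eq_mult)
    finally show "(\<Sum>k = 0..<n. ?K i k * ?B k j) = ?K1 i j"
      using ij by (auto simp: sum_of_bool_eq_mult)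
  qed
  \<comment> \<open>\<open>?A\<close> adds the all-ones row 0 to each other row and subtracts all
    other rows from row 0. Since the columns of \<open>L\<close> sum to 0, the latter gives
    \<open>1 + L 0 j\<close>.\<close>
  have AK1: "?mat ?A * ?mat ?K1 = ?mat (\<lambda>i j. 1 + L i j)"
  proof (rule mat_times_mat)
    fix i j assume ij: "i < n" "j < n"
    have "(\<Sum>k = Suc 0..<n. L k j) = - L 0 j"
      using col[OF ij(2)] split0 by (metis add_eq_0_iff)
    then show "(\<Sum>k = 0..<n. ?A i k * ?K1 k j) = 1 + L i j"
      using ij delta[of i "\<lambda>k. L k j"] by (simp add: split0 sum_negf)
  qed
  \<comment> \<open>Subtracting all other columns from column 0 clears it below the corner and
    leaves \<open>1 + (n - 1) = n\<close> in the corner.\<close>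
  have AP: "?mat ?A * ?mat (?P (- 1)) = ?mat (?U (- 1))"
  proof (rule mat_times_mat)
    fix i j assume ij: "i < n" "j < n"
    have "(\<Sum>k = Suc 0..<n. ?A i k * ?P (- 1) k j) =
        (\<Sum>k = Suc 0..<n. (if i = 0 then - 1 else of_bool (k = i)) * (if j = 0 then - 1 else of_bool (k = j)))"
      by (rule pos) auto
    then show "(\<Sum>k = 0..<n. ?A i k * ?P (- 1) k j) = ?U (- 1) i j"
      using n ij by (cases "i = 0"; cases "j = 0")
        (simp_all add: split0 sum_negf of_nat_diff delta delta1)
  qed
  \<comment> \<open>\<open>?B\<close> is conjugated by \<open>?P (- 1)\<close>, whose inverse is
    \<open>?P 1\<close>: first row 0 is subtracted from the others, then in \<open>QP\<close> the
    other columns are added to column 0.\<close>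
  have PB: "?mat (?P (- 1)) * ?mat ?B = ?mat ?Q"
  proof (rule mat_times_mat)
    fix i j assume ij: "i < n" "j < n"
    have "(\<Sum>k = Suc 0..<n. ?P (- 1) i k * ?B k j) = (\<Sum>k = Suc 0..<n. of_bool (i = k) * ?B k j)"
      by (rule pos) auto
    then show "(\<Sum>k = 0..<n. ?P (- 1) i k * ?B k j) = ?Q i j"
      using ij by (cases "i = 0"; cases "j = 0") (simp_all add: split0 delta')
  qed
  have QP: "?mat ?Q * ?mat (?P 1) = ?mat (?U 1)"
  proof (rule mat_times_mat)
    fix i j assume ij: "i < n" "j < n"
    have "(\<Sum>k = Suc 0..<n. ?Q i k * ?P 1 k j) =
        (\<Sum>k = Suc 0..<n. (if i = 0 then 1 else of_bool (i = k)) * (if j = 0 then 1 else of_bool (k = j)))"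
      by (rule pos) auto
    then show "(\<Sum>k = 0..<n. ?Q i k * ?P 1 k j) = ?U 1 i j"
      using n ij by (cases "i = 0"; cases "j = 0")
        (simp_all add: split0 of_nat_diff delta' delta1)
  qed
  have det_times: "det (?mat f) * det (?mat g) = det (?mat f * ?mat g)" for f g
    by (rule det_mult[symmetric, of _ n]) simp_all
  have "det (?mat ?A) * det (?mat (?P (- 1))) = det (?mat (?U (- 1)))"
    by (simp only: det_times AP)
  then have "det (?mat ?A) = of_nat n"
    using n by (simp only: det_one_mat_upd_col det_one_mat_upd_row mult_1_right)
  moreover have "det (?mat (?P (- 1))) * det (?mat ?B) * det (?mat (?P 1)) = det (?mat (?U 1))"
    by (simp only: det_times PB QP)
  then have "det (?mat ?B) = of_nat n"
    using det_one_mat_upd_row[OF n, of "of_nat n" 1]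
    by (simp only: det_one_mat_upd_col mult_1_right mult_1_left)
  moreover have "det (?mat ?A) * (det (?mat ?K) * det (?mat ?B)) = det (?mat (\<lambda>i j. 1 + L i j))"
    by (simp only: det_times K1 AK1)
  ultimately show ?thesis by (simp add: power2_eq_square mult_ac)
qed

section \<open>From vertices to matrix indices\<close>

context pair_graph
begin

text \<open>Parent maps are conjugated by the enumeration \<open>e\<close> and its inverse
  \<open>t\<close>, and rank functions are composed with them. The value \<open>0\<close> at index
  \<open>0\<close> stands for the root, where a parent map has no parent to choose.\<close>

lemma card_parent_maps_index:
  assumes e: "bij_betw e {0..<n} (pverts G)" and n: "n > 0"
  shows "card (parent_maps G (e 0)) =
    card {h \<in> (\<Pi>\<^sub>E i \<in> {0..<n}. if i = 0 then {0} else {u. u < n \<and> (e i, e u) \<in> parcs G}).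
      \<exists>d :: nat \<Rightarrow> nat. \<forall>i \<in> {1..<n}. d (h i) < d i}"
    (is "_ = card ?H")
proof -
  let ?r = "e 0"
  define t where "t = the_inv_into {0..<n} e"
  have te: "t (e i) = i" if "i < n" for i
    using e that by (auto simp: t_def bij_betw_def the_inv_into_f_f)
  have et: "e (t v) = v" and tn: "t v < n" if "v \<in> pverts G" for v
    using e that the_inv_into_into[of e "{0..<n}" v "{0..<n}"]
    by (auto simp: t_def bij_betw_def f_the_inv_into_f)
  have eV: "e i \<in> pverts G" if "i < n" for i
    using e that by (auto simp: bij_betw_def)
  have er: "e i = ?r \<longleftrightarrow> i = 0" if "i < n" for i
    using te that n by metis
  have t0: "t v = 0 \<longleftrightarrow> v = ?r" if "v \<in> pverts G" for v
    using that te et n by metis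
  have "bij_betw (\<lambda>g. \<lambda>i \<in> {0..<n}. if i = 0 then 0 else t (g (e i))) (parent_maps G ?r) ?H"
  proof (rule bij_betwI[where g = "\<lambda>h. \<lambda>v \<in> pverts G - {?r}. e (h (t v))"])
    show "(\<lambda>g. \<lambda>i \<in> {0..<n}. if i = 0 then 0 else t (g (e i))) \<in> parent_maps G ?r \<rightarrow> ?H"
    proof
      fix g assume g: "g \<in> parent_maps G ?r"
      obtain d :: "'a \<Rightarrow> nat" where d: "\<And>v. v \<in> pverts G - {?r} \<Longrightarrow> d (g v) < d v"
        and arc: "\<And>v. v \<in> pverts G - {?r} \<Longrightarrow> (v, g v) \<in> parcs G"
        and gV: "\<And>v. v \<in> pverts G - {?r} \<Longrightarrow> g v \<in> pverts G"
        using parent_mapsE[OF g] by metis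
      have V: "e i \<in> pverts G - {?r}" if "i < n" "i \<noteq> 0" for i
        using that eV er by blast
      have "t (g (e i)) < n \<and> (e i, e (t (g (e i)))) \<in> parcs G" if "i < n" "i \<noteq> 0" for i
        using V[OF that] gV arc et tn by simp
      moreover have "(d \<circ> e) (t (g (e i))) < (d \<circ> e) i" if "i < n" "i \<noteq> 0" for i
        using V[OF that] gV d et by simp
      ultimately show "(\<lambda>i \<in> {0..<n}. if i = 0 then 0 else t (g (e i))) \<in> ?H"
        by (auto simp: PiE_iff intro!: exI[of _ "d \<circ> e"])
    qed
    show "(\<lambda>h. \<lambda>v \<in> pverts G - {?r}. e (h (t v))) \<in> ?H \<rightarrow> parent_maps G ?r"
    proof
      fix h assume h: "h \<in> ?H"
      then obtain d :: "nat \<Rightarrow> nat" where d: "\<And>i. i \<in> {1..<n} \<Longrightarrow> d (h i) < d i" by blast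
      have arc: "h i < n \<and> (e i, e (h i)) \<in> parcs G" if "i < n" "i \<noteq> 0" for i
        using h that by (auto simp: PiE_iff split: if_splits)
      have V: "t v < n" "t v \<noteq> 0" "e (t v) = v" if "v \<in> pverts G - {?r}" for v
        using that tn t0 et by auto
      have "(v, e (h (t v))) \<in> parcs G" if "v \<in> pverts G - {?r}" for v
        using arc[OF V(1,2)[OF that]] V(3)[OF that] by simp
      moreover have "(d \<circ> t) (e (h (t v))) < (d \<circ> t) v" if "v \<in> pverts G - {?r}" for v
        using arc[OF V(1,2)[OF that]] d[of "t v"] V[OF that] te by simp
      ultimately show "(\<lambda>v \<in> pverts G - {?r}. e (h (t v))) \<in> parent_maps G ?r"
        unfolding parent_maps_def mem_Collect_eq PiE_iff
        by (intro conjI exI[of _ "d \<circ> t"] ballI) simp_all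
    qed
  next
    fix g assume g: "g \<in> parent_maps G ?r"
    have gV: "g v \<in> pverts G" if "v \<in> pverts G - {?r}" for v
      using parent_mapsE[OF g] that by metis
    show "(\<lambda>v \<in> pverts G - {?r}. e ((\<lambda>i \<in> {0..<n}. if i = 0 then 0 else t (g (e i))) (t v))) = g"
    proof (rule extensionalityI)
      show "g \<in> extensional (pverts G - {?r})" using g by (auto simp: parent_maps_def PiE_iff)
    qed (use gV et tn t0 in auto)
  next
    fix h assume h: "h \<in> ?H"
    have hn: "h i < n" if "i < n" for i
      using h that n by (auto simp: PiE_iff split: if_splits)
    have h0: "h 0 = 0" using h n by (auto simp: PiE_iff dest!: bspec[where x = 0])
    show "(\<lambda>i \<in> {0..<n}. if i = 0 then 0 else t ((\<lambda>v \<in> pverts G - {?r}. e (h (t v))) (e i))) = h"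
    proof (rule extensionalityI)
      show "h \<in> extensional {0..<n}" using h by (auto simp: PiE_iff)
    qed (use hn h0 te eV er in auto)
  qed
  then show ?thesis by (rule bij_betw_same_card)
qed

theorem matrix_tree:
  fixes e :: "nat \<Rightarrow> 'a"
  assumes e: "bij_betw e {0..<n} (pverts G)" and n: "n > 0"
  shows "det (mat n n (\<lambda>(i, j). 1 + (of_bool (i = j) * of_nat (card {u. u < n \<and> (e i, e u) \<in> parcs G})
      - of_bool ((e i, e j) \<in> parcs G)))) =
    of_nat n ^ 2 * (of_nat (num_spanning_trees G) :: 'b :: idom)"
proof -
  let ?deg = "\<lambda>i. of_nat (card {u. u < n \<and> (e i, e u) \<in> parcs G}) :: 'b"
  let ?L = "\<lambda>i j. of_bool (i = j) * ?deg i - of_bool ((e i, e j) \<in> parcs G)"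
  \<comment> \<open>Symmetry makes the column sums of the Laplacian vanish along with its row
    sums.\<close>
  have sym: "(e i, e j) \<in> parcs G \<longleftrightarrow> (e j, e i) \<in> parcs G" for i j
    using sym_parcs by blast
  have deg: "(\<Sum>j = 0..<n. of_bool ((e i, e j) \<in> parcs G)) = ?deg i" for i
    by (simp add: sum_of_bool_eq Int_def)
  have row: "(\<Sum>j = 0..<n. ?L i j) = 0" if "i < n" for i
    using that sum_of_bool_eq_mult[of "{0..<n}" i "\<lambda>_. ?deg i"]
    by (simp add: sum_subtractf deg eq_commute[of i])
  have col: "(\<Sum>i = 0..<n. ?L i j) = 0" if "j < n" for j
    using that sum_of_bool_eq_mult[of "{0..<n}" j ?deg]
    by (simp add: sum_subtractf deg sym[of _ j])
  have "det (mat n n (\<lambda>(i, j). 1 + ?L i j)) =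
      of_nat n ^ 2 * det (mat n n (\<lambda>(i, j). if i = 0 then of_bool (j = 0) else ?L i j))"
    by (rule det_all_ones_plus[OF n row col])
  also have "det (mat n n (\<lambda>(i, j). if i = 0 then of_bool (j = 0) else ?L i j)) =
      of_nat (card (parent_maps G (e 0)))"
    unfolding card_parent_maps_index[OF e n] by (rule det_rooted_laplacian[OF n])
  also have "card (parent_maps G (e 0)) = num_spanning_trees G"
    using e n by (intro num_spanning_trees_eq_card_parent_maps[symmetric]) (auto simp: bij_betw_def)
  finally show ?thesis .
qed

end

section \<open>Cyclic tridiagonal determinants\<close>

text \<open>Fixing everything from \<open>n\<close> on makes this a permutation of all naturals, as
  \<open>permutes\<close> and \<open>sign\<close> demand.\<close>

definition cyclic_shift :: "nat \<Rightarrow> nat \<Rightarrow> nat" where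
  "cyclic_shift n i = (if i < n then Suc i mod n else i)"

lemma cyclic_shift_less: "i < n \<Longrightarrow> cyclic_shift n i < n"
  by (simp add: cyclic_shift_def)

lemma funpow_cyclic_shift: "i < n \<Longrightarrow> (cyclic_shift n ^^ k) i = (i + k) mod n"
  by (induction k) (auto simp: cyclic_shift_def mod_Suc_eq)

lemma cyclic_shift_funpow_id: "cyclic_shift n ^^ n = id"
proof
  fix i
  show "(cyclic_shift n ^^ n) i = id i"
  proof (cases "i < n")
    case False
    then have "(cyclic_shift n ^^ k) i = i" for k
      by (induction k) (auto simp: cyclic_shift_def)
    then show ?thesis by simp
  qed (simp add: funpow_cyclic_shift)
qed

lemma cyclic_shift_permutes: "cyclic_shift n permutes {0..<n}"
proof (rule bij_imp_permutes)
  have "inj_on (cyclic_shift n) {0..<n}"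
    by (rule inj_onI) (auto simp: cyclic_shift_def mod_Suc split: if_splits)
  moreover have "cyclic_shift n ` {0..<n} \<subseteq> {0..<n}"
    by (auto simp: cyclic_shift_less)
  ultimately show "bij_betw (cyclic_shift n) {0..<n} {0..<n}"
    by (simp add: bij_betw_def endo_inj_surj)
qed (simp add: cyclic_shift_def)

text \<open>The \<open>n\<close>-th power is the identity, so the sign, being 1 or -1, has odd power
  1.\<close>

lemma sign_cyclic_shift:
  assumes "odd n"
  shows "sign (cyclic_shift n) = 1"
proof -
  have perm: "permutation (cyclic_shift n)"
    using cyclic_shift_permutes permutation_permutes by blast
  have pk: "permutation (cyclic_shift n ^^ k)" for k
    by (induction k) (simp_all only: funpow.simps permutation_id permutation_compose perm)
  have "sign (cyclic_shift n ^^ k) = sign (cyclic_shift n) ^ k" for k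
    by (induction k) (simp_all only: funpow.simps power.simps sign_id sign_compose perm pk)
  from this[of n] have "sign (cyclic_shift n) ^ n = 1"
    by (simp add: cyclic_shift_funpow_id)
  with assms show ?thesis
    by (cases "cyclic_shift n" rule: sign_cases) auto
qed

text \<open>A permutation with a nonzero Leibniz term sends each \<open>i\<close> to itself or to
  its successor. If it moves one point to its successor, injectivity forces it to move that
  successor as well, and so on around the cycle. Only the identity and the full cycle remain, both
  of sign 1.\<close>

lemma det_cyclic_bidiagonal:
  fixes x y :: "'a :: comm_ring_1"
  assumes "odd n" "n > 1"
  shows "det (mat n n (\<lambda>(i, j). of_bool (i = j) * x + of_bool (j = Suc i mod n) * y)) = x ^ n + y ^ n"
    (is "det ?M = _")
proof -
  let ?c = "cyclic_shift n"
  let ?f = "\<lambda>p. signof p * (\<Prod>i = 0..<n. ?M $$ (i, p i))"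
  have c: "?c i = Suc i mod n" "?c i \<noteq> i" if "i < n" for i
    using that \<open>n > 1\<close> by (auto simp: cyclic_shift_def mod_Suc)
  have nfix: "i \<noteq> Suc i mod n" if "i < n" for i
    using c[OF that] by simp
  have zero: "?f p = 0" if p: "p permutes {0..<n}" and "p \<noteq> id" "p \<noteq> ?c" for p
  proof (rule ccontr)
    assume "?f p \<noteq> 0"
    then have nonzero: "(\<Prod>i = 0..<n. ?M $$ (i, p i)) \<noteq> 0" by auto
    have entry: "?M $$ (i, p i) \<noteq> 0" if "i < n" for i
    proof
      assume "?M $$ (i, p i) = 0"
      with that have "(\<Prod>i = 0..<n. ?M $$ (i, p i)) = 0"
        by (intro prod_zero) auto
      with nonzero show False by blast
    qed
    have dich: "p i = i \<or> p i = ?c i" if "i < n" for i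
    proof (rule ccontr)
      assume "\<not> (p i = i \<or> p i = ?c i)"
      moreover have "p i < n" using permutes_in_image[OF p, of i] that by simp
      ultimately have "?M $$ (i, p i) = 0" using that c(1)[OF that] by auto
      with entry[OF that] show False by blast
    qed
    obtain i where i: "p i \<noteq> i"
      using \<open>p \<noteq> id\<close> by (auto simp: fun_eq_iff)
    have "i < n" using i permutes_not_in[OF p, of i] by auto
    have shift: "p ((?c ^^ k) i) = ?c ((?c ^^ k) i)" for k
    proof (induction k)
      case 0
      then show ?case using dich \<open>i < n\<close> i by auto
    next
      case (Suc k)
      have less: "(?c ^^ k) i < n" using \<open>i < n\<close> by (simp add: funpow_cyclic_shift)
      have "p (?c ((?c ^^ k) i)) \<noteq> ?c ((?c ^^ k) i)"
        using Suc.IH c(2)[OF less] permutes_inj[OF p] by (metis injD)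
      then show ?case using dich[OF cyclic_shift_less[OF less]] by auto
    qed
    have "p j = ?c j" for j
    proof (cases "j < n")
      case True
      \<comment> \<open>The exponent is \<open>j - i\<close> modulo \<open>n\<close>, shifted by
        \<open>n\<close> to avoid truncated subtraction.\<close>
      have "(?c ^^ (n - i + j)) i = j"
        using True \<open>i < n\<close> by (simp add: funpow_cyclic_shift)
      then show ?thesis using shift by metis
    next
      case False
      then show ?thesis using permutes_not_in[OF p, of j] by (simp add: cyclic_shift_def)
    qed
    then show False using \<open>p \<noteq> ?c\<close> by blast
  qed
  have "id \<noteq> ?c" using c(2)[of 0] \<open>n > 1\<close> by (auto simp: fun_eq_iff intro!: exI[of _ 0])
  have "det ?M = (\<Sum>p | p permutes {0..<n}. ?f p)"
    by (rule det_def') simp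
  also have "\<dots> = (\<Sum>p \<in> {id, ?c}. ?f p)"
    using zero by (intro sum.mono_neutral_right)
      (auto simp: finite_permutations permutes_id cyclic_shift_permutes)
  also have "\<dots> = ?f id + ?f ?c"
    using \<open>id \<noteq> ?c\<close> by simp
  also have "(\<Prod>i = 0..<n. ?M $$ (i, id i)) = (\<Prod>i = 0..<n. x)"
    by (intro prod.cong) (auto simp: nfix)
  also have "(\<Prod>i = 0..<n. ?M $$ (i, ?c i)) = (\<Prod>i = 0..<n. y)"
    by (intro prod.cong) (auto simp: nfix c(1))
  finally show ?thesis by (simp add: sign_cyclic_shift \<open>odd n\<close>)
qed

lemma det_cyclic_tridiagonal:
  fixes x y :: "'a :: comm_ring_1"
  assumes "odd n" "n > 1" and "x * y = 1"
  shows "det (mat n n (\<lambda>(i, j). of_bool (i = j) * (x + y) + of_bool (j = Suc i mod n)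
    + of_bool (i = Suc j mod n))) = x ^ n + y ^ n + 2"
proof -
  \<comment> \<open>With the cyclic shift \<open>S\<close>, the matrix is \<open>(x + S) * (1 + y * transpose S)\<close>, since
    \<open>S * transpose S = 1\<close>.\<close>
  let ?A = "\<lambda>i j. of_bool (i = j) * x + of_bool (j = Suc i mod n) * 1"
  let ?B = "\<lambda>i j. of_bool (i = j) * 1 + of_bool (j = Suc i mod n) * y"
  let ?A = "mat n n (\<lambda>(i, j). ?A i j)"
  let ?B = "mat n n (\<lambda>(i, j). ?B j i)"
  have inj: "Suc i mod n = Suc j mod n \<longleftrightarrow> i = j" if "i < n" "j < n" for i j
    using that by (auto simp: mod_Suc split: if_splits)
  have "?A * ?B = mat n n (\<lambda>(i, j). of_bool (i = j) * (x + y) + of_bool (j = Suc i mod n)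
    + of_bool (i = Suc j mod n))"
  proof (rule mat_times_mat)
    fix i j assume ij: "i < n" "j < n"
    have "(\<Sum>k = 0..<n. (of_bool (i = k) * x + of_bool (k = Suc i mod n) * 1) *
        (of_bool (j = k) * 1 + of_bool (k = Suc j mod n) * y)) =
      (\<Sum>k = 0..<n. of_bool (k = i) * (x * (of_bool (j = k) + of_bool (k = Suc j mod n) * y))) +
      (\<Sum>k = 0..<n. of_bool (k = Suc i mod n) * (of_bool (j = k) + of_bool (k = Suc j mod n) * y))"
      unfolding sum.distrib[symmetric]
      by (rule sum.cong) (auto simp: algebra_simps)
    also have "\<dots> = x * (of_bool (j = i) + of_bool (i = Suc j mod n) * y) +
        (of_bool (j = Suc i mod n) + of_bool (Suc i mod n = Suc j mod n) * y)"
      using ij by (simp add: sum_of_bool_eq_mult)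
    \<comment> \<open>\<open>inj\<close> reduces \<open>S * transpose S\<close> to the identity,
      contributing \<open>y\<close> on the diagonal; \<open>x * y = 1\<close> removes the
      coefficient of \<open>transpose S\<close>.\<close>
    also have "\<dots> = of_bool (i = j) * (x + y) + of_bool (j = Suc i mod n) + of_bool (i = Suc j mod n)"
      using assms(3) by (auto simp: inj[OF ij] algebra_simps)
    finally show "(\<Sum>k = 0..<n. (of_bool (i = k) * x + of_bool (k = Suc i mod n) * 1) *
        (of_bool (j = k) * 1 + of_bool (k = Suc j mod n) * y)) =
      of_bool (i = j) * (x + y) + of_bool (j = Suc i mod n) + of_bool (i = Suc j mod n)" .
  qed
  moreover have "det (?A * ?B) = det ?A * det ?B"
    by (rule det_mult[of _ n]) simp_all
  moreover have "det ?A = x ^ n + 1"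
    using det_cyclic_bidiagonal[OF assms(1,2), of x 1] by simp
  moreover have "det ?B = 1 + y ^ n"
  proof -
    have "?B = transpose_mat (mat n n (\<lambda>(i, j). of_bool (i = j) * 1 + of_bool (j = Suc i mod n) * y))"
      by (rule eq_matI) auto
    then show ?thesis
      using det_cyclic_bidiagonal[OF assms(1,2), of 1 y] by (simp add: det_transpose[of _ n])
  qed
  moreover have "x ^ n * y ^ n = 1"
    using assms(3) by (simp add: power_mult_distrib[symmetric])
  ultimately show ?thesis by (simp add: algebra_simps)
qed

section \<open>The complement of a cycle\<close>

lemma cong_diff_one_iff:
  assumes "i < N"
  shows "[int i - int j = 1] (mod int N) \<longleftrightarrow> i = Suc j mod N"
proof -
  have "[int i - int j = 1] (mod int N) \<longleftrightarrow> [int i = int (Suc j)] (mod int N)"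
    by (simp add: cong_iff_dvd_diff algebra_simps)
  also have "\<dots> \<longleftrightarrow> i = Suc j mod N"
    using assms by (simp only: cong_int_iff) (simp add: cong_def)
  finally show ?thesis .
qed

lemma cong_diff_minus_one_iff:
  assumes "j < N"
  shows "[int i - int j = - 1] (mod int N) \<longleftrightarrow> j = Suc i mod N"
  using cong_diff_one_iff[OF assms, of i] cong_minus_minus_iff[of "int j - int i" 1 "int N"] by simp

lemma parcs_complete_minus_cycle:
  assumes "i < N" "j < N"
  shows "(int i, int j) \<in> parcs (complete_minus_cycle N) \<longleftrightarrow>
    i \<noteq> j \<and> i \<noteq> Suc j mod N \<and> j \<noteq> Suc i mod N"
  using assms by (simp add: complete_minus_cycle_def cong_diff_one_iff cong_diff_minus_one_iff)

text \<open>The non-neighbours of \<open>i\<close> are \<open>i\<close> itself, its successor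
  \<open>s\<close> and its predecessor \<open>p\<close> on the cycle, distinct since
  \<open>N\<close> is at least 3.\<close>

lemma card_neighbours_complete_minus_cycle:
  assumes "N \<ge> 3" "i < N"
  shows "card {u. u < N \<and> (int i, int u) \<in> parcs (complete_minus_cycle N)} = N - 3"
proof -
  define s where "s = Suc i mod N"
  define p where "p = (if i = 0 then N - 1 else i - 1)"
  have pred: "i = Suc u mod N \<longleftrightarrow> u = p" if "u < N" for u
    using that assms by (auto simp: p_def mod_Suc)
  have "{u. u < N \<and> (int i, int u) \<in> parcs (complete_minus_cycle N)} = {0..<N} - {i, s, p}"
    using assms pred by (auto simp: parcs_complete_minus_cycle s_def)
  moreover have "card {i, s, p} = 3"
    using assms by (auto simp: s_def p_def mod_Suc card_insert_if)
  moreover have "{i, s, p} \<subseteq> {0..<N}"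
    using assms by (auto simp: s_def p_def)
  ultimately show ?thesis by (simp add: card_Diff_subset)
qed

theorem theorem4p5:
  fixes N :: nat
  assumes "N \<ge> 5" and "odd N"
  shows "real (num_spanning_trees (complete_minus_cycle N)) = (pisa N N + 2) / (real N)\<^sup>2"
proof -
  let ?G = "complete_minus_cycle N"
  let ?a = "pisa_alpha N" and ?b = "pisa_beta N"
  interpret pair_graph ?G by (rule pair_graph_complete_minus_cycle)
  have sum: "?a + ?b = real N - 2"
    by (simp add: pisa_alpha_def pisa_beta_def field_simps)
  \<comment> \<open>The discriminant is nonnegative for these \<open>N\<close>, so the real root
    squares back to it.\<close>
  have "sqrt (pisa_disc N) * sqrt (pisa_disc N) = real N * (real N - 4)"
    using assms by (simp add: pisa_disc_def)
  then have prod: "?a * ?b = 1"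
    unfolding pisa_alpha_def pisa_beta_def by (simp add: field_simps)
  have e: "bij_betw int {0..<N} (pverts ?G)"
    by (simp add: bij_betw_def complete_minus_cycle_def image_int_atLeastLessThan)
  \<comment> \<open>The diagonal is \<open>1 + (N - 3) = N - 2\<close>. Off it, the 1 cancels at
    adjacent pairs and survives at the missing cycle edges.\<close>
  have "mat N N (\<lambda>(i, j). 1 + (of_bool (i = j) * of_nat (card {u. u < N \<and> (int i, int u) \<in> parcs ?G})
      - of_bool ((int i, int j) \<in> parcs ?G))) =
    mat N N (\<lambda>(i, j). of_bool (i = j) * (?a + ?b) + of_bool (j = Suc i mod N) + of_bool (i = Suc j mod N))"
    (is "?L = ?R")
  proof (rule eq_matI)
    fix i j assume "i < dim_row ?R" "j < dim_col ?R"
    then have ij: "i < N" "j < N" by auto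
    \<comment> \<open>The three indicators on the right are mutually exclusive, so no two of them
      add up in one entry.\<close>
    then have "\<not> (j = Suc i mod N \<and> i = Suc j mod N)" "j = i \<longrightarrow> j \<noteq> Suc i mod N"
      using assms by (auto simp: mod_Suc split: if_splits)
    with ij assms show "?L $$ (i, j) = ?R $$ (i, j)"
      by (auto simp: sum parcs_complete_minus_cycle card_neighbours_complete_minus_cycle of_nat_diff)
  qed simp_all
  then have "(real N)\<^sup>2 * real (num_spanning_trees ?G) = ?a ^ N + ?b ^ N + 2"
    using matrix_tree[OF e, where ?'b = real] det_cyclic_tridiagonal[OF assms(2) _ prod] assms by simp
  then show ?thesis
    using assms by (simp add: pisa_def field_simps)
qed

end
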